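(* Let $n\ge2$. Every Kropina space $(\mathbb{E}^n,F)$ of constant flag curvature $K=0$, i.e. the one induced by the navigation data $(h,W)$ with $h=(\delta_{ij})$ the flat metric and $W=C^i\frac{\partial}{\partial x^i}$ for a constant vector $(C^i)$ of unit length, is projectively flat.
   Context: Kropina space induced by navigation data $(h,W)$ (with $h(W,W)=1$): the conic Finsler metric $F(x,y)=\frac{h(y,y)}{2h(y,W)}$ on $A=\{(x,y)\in TM: h(y,W_x)>0\}$. A conic Finsler metric $F:A\to(0,\infty)$ is projectively flat if it is with rectilinear extremals, i.e. the manifold is covered by coordinate neighborhoods in which its geodesics are straight lines as point sets; equivalently in these coordinates Hamel's relation $\frac{\partial^2F}{\partial x^r\partial y^j}y^r-\frac{\partial F}{\partial x^j}=0$ holds for all $(x,y)\in A$. *)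

theory Defs
  imports "HOL-Analysis.Analysis"
begin

section \<open>Differentiability classes and charts\<close>

text \<open>
  Classes \<open>C\<^sup>k\<close> on an open set, by iterated directional derivatives; in finite dimension
  this is the usual notion. It is only meant for open \<open>S\<close>, since derivatives are taken
  \<^term>\<open>at x\<close> and not within \<open>S\<close>.
\<close>

primrec Ck_on :: "nat \<Rightarrow> 'a::euclidean_space set \<Rightarrow> ('a \<Rightarrow> 'b::euclidean_space) \<Rightarrow> bool" where
  "Ck_on 0 S f \<longleftrightarrow> continuous_on S f"
| "Ck_on (Suc k) S f \<longleftrightarrow>
     (\<forall>x\<in>S. f differentiable at x) \<and> (\<forall>v. Ck_on k S (\<lambda>x. frechet_derivative f (at x) v))"

definition smooth_on :: "'a::euclidean_space set \<Rightarrow> ('a \<Rightarrow> 'b::euclidean_space) \<Rightarrow> bool" where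
  "smooth_on S f \<longleftrightarrow> (\<forall>k. Ck_on k S f)"

definition coordinate_chart :: "'a::euclidean_space set \<Rightarrow> ('a \<Rightarrow> 'a) \<Rightarrow> bool" where
  "coordinate_chart U \<phi> \<longleftrightarrow>
     open U \<and> inj_on \<phi> U \<and> open (\<phi> ` U) \<and> smooth_on U \<phi> \<and> smooth_on (\<phi> ` U) (inv_into U \<phi>)"

section \<open>Extremals and projective flatness\<close>

text \<open>
  The manifold is the whole space \<open>'a\<close>, its tangent bundle is \<open>'a \<times> 'a\<close>, and a conic
  metric is a function \<open>F x y\<close> of which only the values for \<open>(x, y) \<in> A\<close> matter, with
  \<open>A\<close> open. Curves are parametrised by open intervals.
\<close>

definition admissible_curve ::
    "('a::euclidean_space \<times> 'a) set \<Rightarrow> real set \<Rightarrow> (real \<Rightarrow> 'a) \<Rightarrow> bool" where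
  "admissible_curve A I c \<longleftrightarrow>
     open I \<and> is_interval I \<and> I \<noteq> {} \<and> Ck_on 2 I c \<and>
     (\<forall>t\<in>I. (c t, vector_derivative c (at t)) \<in> A)"

text \<open>
  Geodesics as point sets are the extremals of the length functional \<open>\<integral> F(c, c') dt\<close>.
  The Euler-Lagrange equation \<open>d/dt F\<^sub>y(c, c') = F\<^sub>x(c, c')\<close> of \<open>F\<close> (and not of \<open>F\<^sup>2\<close>)
  is used, tested in every direction \<open>v\<close>; by homogeneity of \<open>F\<close> it does not depend on the
  (orientation-preserving) parametrisation, so no constant speed is imposed.
\<close>

definition geodesic ::
    "('a::euclidean_space \<times> 'a) set \<Rightarrow> ('a \<Rightarrow> 'a \<Rightarrow> real) \<Rightarrow> real set \<Rightarrow> (real \<Rightarrow> 'a) \<Rightarrow> bool" where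
  "geodesic A F I c \<longleftrightarrow>
     admissible_curve A I c \<and>
     (\<forall>t\<in>I. \<forall>v.
        ((\<lambda>s. frechet_derivative (\<lambda>y. F (c s) y) (at (vector_derivative c (at s))) v)
           has_real_derivative
         frechet_derivative (\<lambda>x. F x (vector_derivative c (at t))) (at (c t)) v) (at t))"

text \<open>
  In each of the coordinate neighbourhoods the geodesics are precisely the admissible curves
  whose trace is part of a straight line. Both directions are demanded: that straight lines
  are extremals is what Hamel's relation expresses, and for a metric with positive definite
  fundamental tensor the two directions are equivalent.
\<close>

definition projectively_flat ::
    "('a::euclidean_space \<times> 'a) set \<Rightarrow> ('a \<Rightarrow> 'a \<Rightarrow> real) \<Rightarrow> bool" where
  "projectively_flat A F \<longleftrightarrow>
     (\<forall>x. \<exists>U \<phi>. x \<in> U \<and> coordinate_chart U \<phi> \<and>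
        (\<forall>I c. admissible_curve A I c \<and> c ` I \<subseteq> U \<longrightarrow>
           (geodesic A F I c \<longleftrightarrow> collinear (\<phi> ` c ` I))))"

section \<open>Kropina spaces\<close>

definition kropina_domain ::
    "('a \<Rightarrow> 'a \<Rightarrow> 'a \<Rightarrow> real) \<Rightarrow> ('a \<Rightarrow> 'a) \<Rightarrow> ('a \<times> 'a) set" where
  "kropina_domain h W = {(x, y). h x y (W x) > 0}"

definition kropina_metric ::
    "('a \<Rightarrow> 'a \<Rightarrow> 'a \<Rightarrow> real) \<Rightarrow> ('a \<Rightarrow> 'a) \<Rightarrow> 'a \<Rightarrow> 'a \<Rightarrow> real" where
  "kropina_metric h W x y = h x y y / (2 * h x y (W x))"

definition navigation_data ::
    "('a \<Rightarrow> 'a \<Rightarrow> 'a \<Rightarrow> real) \<Rightarrow> ('a \<Rightarrow> 'a) \<Rightarrow> bool" where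
  "navigation_data h W \<longleftrightarrow> (\<forall>x. h x (W x) (W x) = 1)"

definition flat_metric :: "real ^ 'n \<Rightarrow> real ^ 'n \<Rightarrow> real ^ 'n \<Rightarrow> real" where
  "flat_metric x u v = u \<bullet> v"

end

theory Submission
  imports Defs
begin

text \<open>
  The Euclidean coordinates already straighten the geodesics. The metric
  \<open>F y = (y \<bullet> y) / (2 (y \<bullet> C))\<close> does not depend on the position, so the extremals are the
  curves along which \<open>F\<^sub>y\<close> is constant. In terms of \<open>u = y / (y \<bullet> C)\<close> the gradient
  of \<open>F\<close> at \<open>y\<close> is \<open>u - (u \<bullet> u / 2) C\<close>. As \<open>u \<bullet> C = 1\<close> and \<open>C\<close> is a unit vector, pairing the
  gradient with \<open>C\<close> recovers \<open>u \<bullet> u\<close>, hence \<open>u\<close>: the gradient is constant along a curve if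
  and only if the direction of the velocity is.
\<close>

lemma Ck_on_const: "Ck_on k S (\<lambda>x. a)"
  by (induction k arbitrary: a) auto

lemma smooth_on_ident: "smooth_on S (\<lambda>x. x)"
  unfolding smooth_on_def
proof
  fix k show "Ck_on k S (\<lambda>x. x)"
    \<comment> \<open>The derivative of the identity in direction \<open>v\<close> is the constant
      \<open>v\<close>, so one unfolding reduces to constants.\<close>
    by (cases k) (auto simp: Ck_on_const)
qed

lemma coordinate_chart_ident: "coordinate_chart UNIV (\<lambda>x. x)"
proof -
  have "inv_into UNIV (\<lambda>x::'a. x) = (\<lambda>x. x)"
    using inv_id by (simp add: id_def)
  then show ?thesis
    by (simp add: coordinate_chart_def smooth_on_ident)
qed

lemma admissible_curve_has_vector_derivative:
  assumes "admissible_curve A I c" and "t \<in> I"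
  shows "(c has_vector_derivative vector_derivative c (at t)) (at t)"
  using assms by (simp add: admissible_curve_def numeral_2_eq_2 vector_derivative_works[symmetric])

text \<open>Quotient rule, arranged as a pairing with \<open>v\<close> so that the gradient of the
  metric can be read off as a vector.\<close>

lemma frechet_derivative_flat_kropina:
  fixes y C v :: "'a::euclidean_space"
  assumes "y \<bullet> C \<noteq> 0"
  shows "frechet_derivative (\<lambda>y. y \<bullet> y / (2 * (y \<bullet> C))) (at y) v =
    ((1 / (y \<bullet> C)) *\<^sub>R y - (y \<bullet> y / (2 * (y \<bullet> C)^2)) *\<^sub>R C) \<bullet> v"
proof -
  have "((\<lambda>y. y \<bullet> y / (2 * (y \<bullet> C))) has_derivative
      (\<lambda>v. ((1 / (y \<bullet> C)) *\<^sub>R y - (y \<bullet> y / (2 * (y \<bullet> C)^2)) *\<^sub>R C) \<bullet> v)) (at y)"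
    using assms
    by (auto intro!: derivative_eq_intros
        simp: fun_eq_iff field_simps power2_eq_square inner_commute inner_diff_right)
  then show ?thesis
    by (simp add: frechet_derivative_at[symmetric])
qed

lemma flat_kropina_gradient_eq_iff:
  fixes y z C :: "'a::real_inner"
  assumes "C \<bullet> C = 1" and "y \<bullet> C \<noteq> 0" and "z \<bullet> C \<noteq> 0"
  shows "(1 / (y \<bullet> C)) *\<^sub>R y - (y \<bullet> y / (2 * (y \<bullet> C)^2)) *\<^sub>R C =
      (1 / (z \<bullet> C)) *\<^sub>R z - (z \<bullet> z / (2 * (z \<bullet> C)^2)) *\<^sub>R C \<longleftrightarrow>
    (1 / (y \<bullet> C)) *\<^sub>R y = (1 / (z \<bullet> C)) *\<^sub>R z"
    (is "?u - ?p *\<^sub>R C = ?w - ?q *\<^sub>R C \<longleftrightarrow> _")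
proof
  assume eq: "?u - ?p *\<^sub>R C = ?w - ?q *\<^sub>R C"
  \<comment> \<open>\<open>?u\<close> and \<open>?w\<close> both have inner product 1 with the unit
    vector \<open>C\<close>, so this says \<open>1 - ?p = 1 - ?q\<close>.\<close>
  then have "(?u - ?p *\<^sub>R C) \<bullet> C = (?w - ?q *\<^sub>R C) \<bullet> C"
    by simp
  then have "?p = ?q"
    using assms by (simp add: inner_diff_left)
  with eq show "?u = ?w" by simp
next
  \<comment> \<open>The coefficient of \<open>C\<close> is itself a function of the normalised
    vector.\<close>
  have p: "?p = ?u \<bullet> ?u / 2" and q: "?q = ?w \<bullet> ?w / 2"
    using assms by (simp_all add: power2_eq_square)
  assume "?u = ?w"
  then show "?u - ?p *\<^sub>R C = ?w - ?q *\<^sub>R C"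
    unfolding p q by simp
qed

lemma has_vector_derivative_locally_constant:
  assumes f: "(f has_vector_derivative f') (at t)" and "open S" and "t \<in> S"
    and "\<And>s. s \<in> S \<Longrightarrow> f s = a"
  shows "f' = 0"
proof -
  have "((\<lambda>s. a) has_vector_derivative f') (at t)"
    by (rule has_vector_derivative_transform_within_open[OF f \<open>open S\<close> \<open>t \<in> S\<close>]) fact
  then show ?thesis
    by (rule vector_derivative_unique_at[OF _ has_vector_derivative_const])
qed

text \<open>By positivity the height \<open>c t \<bullet> C\<close> has nonzero speed, and the
  normalised velocity is the derivative of the curve with respect to this height. It is constant
  exactly when the curve is affine in its height, whatever the parametrisation.\<close>

lemma collinear_image_iff_constant_direction:
  fixes c :: "real \<Rightarrow> 'a::real_inner"
  assumes "open I" and "is_interval I"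
    and deriv: "\<And>t. t \<in> I \<Longrightarrow> (c has_vector_derivative c' t) (at t)"
    and pos: "\<And>t. t \<in> I \<Longrightarrow> c' t \<bullet> C > 0"
  shows "collinear (c ` I) \<longleftrightarrow> (\<exists>e. \<forall>t\<in>I. (1 / (c' t \<bullet> C)) *\<^sub>R c' t = e)"
proof
  assume "\<exists>e. \<forall>t\<in>I. (1 / (c' t \<bullet> C)) *\<^sub>R c' t = e"
  then obtain e where e: "\<And>t. t \<in> I \<Longrightarrow> (1 / (c' t \<bullet> C)) *\<^sub>R c' t = e"
    by blast
  have c': "c' t = (c' t \<bullet> C) *\<^sub>R e" if "t \<in> I" for t
    using pos[OF that] by (simp flip: e[OF that])
  \<comment> \<open>Sliding each point back along \<open>e\<close> by its height cancels the
    velocity, so all points of the curve land on one point \<open>a\<close>.\<close>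
  have "((\<lambda>t. c t - (c t \<bullet> C) *\<^sub>R e) has_vector_derivative 0) (at t within I)" if "t \<in> I" for t
  proof -
    have "((\<lambda>t. c t - (c t \<bullet> C) *\<^sub>R e) has_vector_derivative (c' t - (c' t \<bullet> C) *\<^sub>R e)) (at t)"
      using deriv[OF that] unfolding has_vector_derivative_def
      by (auto intro!: derivative_eq_intros simp: algebra_simps)
    then show ?thesis
      using c'[OF that] by (simp add: has_vector_derivative_at_within)
  qed
  then obtain a where a: "\<And>t. t \<in> I \<Longrightarrow> c t - (c t \<bullet> C) *\<^sub>R e = a"
    using has_vector_derivative_zero_constant[OF is_interval_convex[OF \<open>is_interval I\<close>]] by blast
  have "c s - c t = (c s \<bullet> C - c t \<bullet> C) *\<^sub>R e" if "s \<in> I" "t \<in> I" for s t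
  proof -
    have "(c s - (c s \<bullet> C) *\<^sub>R e) - (c t - (c t \<bullet> C) *\<^sub>R e) = 0"
      using a that by simp
    then show ?thesis
      by (simp add: algebra_simps)
  qed
  then show "collinear (c ` I)"
    unfolding collinear_def by blast
next
  assume "collinear (c ` I)"
  then obtain d where d: "\<And>s t. s \<in> I \<Longrightarrow> t \<in> I \<Longrightarrow> \<exists>k. c s - c t = k *\<^sub>R d"
    unfolding collinear_def by blast
  \<comment> \<open>The normalisation removes both length and sign, so it does not matter whether
    \<open>d\<close> points along the motion or against it.\<close>
  have "(1 / (c' t \<bullet> C)) *\<^sub>R c' t = (1 / (d \<bullet> C)) *\<^sub>R d" if t: "t \<in> I" for t
  proof -
    \<comment> \<open>Collinearity gives a factor \<open>k\<close> depending on \<open>s\<close>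
      with no stated regularity. This combination eliminates \<open>k\<close> and can be
      differentiated in \<open>s\<close>.\<close>
    have "(d \<bullet> C) *\<^sub>R (c s - c t) - ((c s - c t) \<bullet> C) *\<^sub>R d = 0" if "s \<in> I" for s
      using d[OF that t] by auto
    moreover have "((\<lambda>s. (d \<bullet> C) *\<^sub>R (c s - c t) - ((c s - c t) \<bullet> C) *\<^sub>R d)
        has_vector_derivative ((d \<bullet> C) *\<^sub>R c' t - (c' t \<bullet> C) *\<^sub>R d)) (at t)"
      using deriv[OF t] unfolding has_vector_derivative_def
      by (auto intro!: derivative_eq_intros simp: algebra_simps)
    ultimately have "(d \<bullet> C) *\<^sub>R c' t - (c' t \<bullet> C) *\<^sub>R d = 0"
      using has_vector_derivative_locally_constant[OF _ \<open>open I\<close> t] by blast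
    then have eq: "(d \<bullet> C) *\<^sub>R c' t = (c' t \<bullet> C) *\<^sub>R d"
      by simp
    \<comment> \<open>Otherwise \<open>eq\<close> forces \<open>d = 0\<close>, the curve stands
      still, and its velocity cannot have a positive component along \<open>C\<close>.\<close>
    have "d \<bullet> C \<noteq> 0"
    proof
      assume "d \<bullet> C = 0"
      with eq pos[OF t] have "d = 0" by simp
      then have "c s = c t" if "s \<in> I" for s
        using d[OF that t] by auto
      then have "c' t = 0"
        by (rule has_vector_derivative_locally_constant[OF deriv[OF t] \<open>open I\<close> t])
      with pos[OF t] show False by simp
    qed
    have "(1 / (c' t \<bullet> C)) *\<^sub>R (1 / (d \<bullet> C)) *\<^sub>R ((d \<bullet> C) *\<^sub>R c' t) =
        (1 / (c' t \<bullet> C)) *\<^sub>R (1 / (d \<bullet> C)) *\<^sub>R ((c' t \<bullet> C) *\<^sub>R d)"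
      by (simp only: eq)
    then show ?thesis
      using \<open>d \<bullet> C \<noteq> 0\<close> pos[OF t] by simp
  qed
  then show "\<exists>e. \<forall>t\<in>I. (1 / (c' t \<bullet> C)) *\<^sub>R c' t = e" by blast
qed

text \<open>Constancy is put as equality of any two values, without naming the constant, so that the
  test direction \<open>v\<close> can later be moved inside the quantifiers over times.\<close>

lemma has_real_derivative_zero_on_iff_constant:
  fixes f :: "real \<Rightarrow> real"
  assumes "open I" and "is_interval I"
  shows "(\<forall>t\<in>I. (f has_real_derivative 0) (at t)) \<longleftrightarrow> (\<forall>s\<in>I. \<forall>t\<in>I. f s = f t)"
proof
  assume "\<forall>t\<in>I. (f has_real_derivative 0) (at t)"
  then have "\<And>t. t \<in> I \<Longrightarrow> (f has_real_derivative 0) (at t within I)"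
    by (simp add: has_field_derivative_at_within)
  then obtain a where "\<And>t. t \<in> I \<Longrightarrow> f t = a"
    using has_field_derivative_zero_constant[OF is_interval_convex[OF \<open>is_interval I\<close>], of f] by blast
  then show "\<forall>s\<in>I. \<forall>t\<in>I. f s = f t" by simp
next
  assume eq: "\<forall>s\<in>I. \<forall>t\<in>I. f s = f t"
  show "\<forall>t\<in>I. (f has_real_derivative 0) (at t)"
  proof
    fix t assume "t \<in> I"
    then show "(f has_real_derivative 0) (at t)"
      using has_field_derivative_transform_within_open[OF DERIV_const \<open>open I\<close>, of t "f t" f] eq
      by blast
  qed
qed

lemma geodesic_flat_kropina_iff_collinear:
  fixes C :: "real ^ 'n"
  assumes C: "C \<bullet> C = 1"
    and adm: "admissible_curve (kropina_domain flat_metric (\<lambda>x. C)) I c"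
  shows "geodesic (kropina_domain flat_metric (\<lambda>x. C)) (kropina_metric flat_metric (\<lambda>x. C)) I c
    \<longleftrightarrow> collinear (c ` I)"
proof -
  define c' where "c' t = vector_derivative c (at t)" for t
  define G where "G y = (1 / (y \<bullet> C)) *\<^sub>R y - (y \<bullet> y / (2 * (y \<bullet> C)^2)) *\<^sub>R C" for y
  have I: "open I" "is_interval I"
    using adm by (simp_all add: admissible_curve_def)
  have pos: "c' t \<bullet> C > 0" if "t \<in> I" for t
    using adm that by (auto simp: admissible_curve_def kropina_domain_def flat_metric_def c'_def)
  have deriv: "(c has_vector_derivative c' t) (at t)" if "t \<in> I" for t
    using admissible_curve_has_vector_derivative[OF adm that] by (simp add: c'_def)
  have Fy: "frechet_derivative (\<lambda>y. kropina_metric flat_metric (\<lambda>x. C) x y) (at (c' t)) v = G (c' t) \<bullet> v"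
    if "t \<in> I" for t x v
    using frechet_derivative_flat_kropina[of "c' t" C v] pos[OF that]
    by (simp add: kropina_metric_def flat_metric_def G_def)
  have Fx: "frechet_derivative (\<lambda>x. kropina_metric flat_metric (\<lambda>x. C) x y) (at x) v = 0" for x y v
    by (simp add: kropina_metric_def flat_metric_def)
  \<comment> \<open>The gradient formula \<open>Fy\<close> is available only at times in
    \<open>I\<close>; since \<open>I\<close> is open, this covers a neighbourhood of
    \<open>t\<close>, which determines the derivative there.\<close>
  have cong: "((\<lambda>s. frechet_derivative (\<lambda>y. kropina_metric flat_metric (\<lambda>x. C) (c s) y) (at (c' s)) v)
        has_real_derivative 0) (at t) \<longleftrightarrow> ((\<lambda>s. G (c' s) \<bullet> v) has_real_derivative 0) (at t)"
    if "t \<in> I" for t v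
  proof (rule DERIV_cong_ev[OF refl _ refl])
    show "\<forall>\<^sub>F s in nhds t. frechet_derivative (\<lambda>y. kropina_metric flat_metric (\<lambda>x. C) (c s) y)
        (at (c' s)) v = G (c' s) \<bullet> v"
      using eventually_nhds_in_open[OF \<open>open I\<close> that] by (rule eventually_mono) (rule Fy)
  qed
  have "geodesic (kropina_domain flat_metric (\<lambda>x. C)) (kropina_metric flat_metric (\<lambda>x. C)) I c
      \<longleftrightarrow> (\<forall>t\<in>I. \<forall>v. ((\<lambda>s. G (c' s) \<bullet> v) has_real_derivative 0) (at t))"
    unfolding geodesic_def c'_def[symmetric] Fx
    using adm cong by simp
  also have "\<dots> \<longleftrightarrow> (\<forall>v. \<forall>t\<in>I. ((\<lambda>s. G (c' s) \<bullet> v) has_real_derivative 0) (at t))"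
    by blast
  also have "\<dots> \<longleftrightarrow> (\<forall>v. \<forall>s\<in>I. \<forall>t\<in>I. G (c' s) \<bullet> v = G (c' t) \<bullet> v)"
    by (simp only: has_real_derivative_zero_on_iff_constant[OF I])
  \<comment> \<open>With \<open>v\<close> innermost, nondegeneracy of the inner product turns the
    scalar conservation laws into one equation between gradients.\<close>
  also have "\<dots> \<longleftrightarrow> (\<forall>s\<in>I. \<forall>t\<in>I. \<forall>v. v \<bullet> G (c' s) = v \<bullet> G (c' t))"
    by (auto simp: inner_commute)
  also have "\<dots> \<longleftrightarrow> (\<forall>s\<in>I. \<forall>t\<in>I. G (c' s) = G (c' t))"
    by (simp only: vector_eq_ldot vector_eq_rdot)
  also have "\<dots> \<longleftrightarrow> (\<forall>s\<in>I. \<forall>t\<in>I. (1 / (c' s \<bullet> C)) *\<^sub>R c' s = (1 / (c' t \<bullet> C)) *\<^sub>R c' t)"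
    unfolding G_def
    by (intro ball_cong refl flat_kropina_gradient_eq_iff[OF C]) (simp_all add: pos less_imp_neq[symmetric])
  also have "\<dots> \<longleftrightarrow> (\<exists>e. \<forall>t\<in>I. (1 / (c' t \<bullet> C)) *\<^sub>R c' t = e)"
    by (cases "I = {}") auto
  also have "\<dots> \<longleftrightarrow> collinear (c ` I)"
    using collinear_image_iff_constant_direction[OF I deriv pos] by simp
  finally show ?thesis .
qed

theorem theorem8p6:
  fixes C :: "real ^ 'n" and h :: "real ^ 'n \<Rightarrow> real ^ 'n \<Rightarrow> real ^ 'n \<Rightarrow> real"
    and W :: "real ^ 'n \<Rightarrow> real ^ 'n"
  assumes "CARD('n) \<ge> 2"
    and "h = flat_metric"
    and "W = (\<lambda>x. C)"
    and "navigation_data h W"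
  shows "projectively_flat (kropina_domain h W) (kropina_metric h W)"
proof -
  have "C \<bullet> C = 1"
    using assms by (simp add: navigation_data_def flat_metric_def)
  then show ?thesis
    unfolding projectively_flat_def assms(2,3)
    \<comment> \<open>One global chart, the identity, serves every point.\<close>
    by (intro allI exI[of _ UNIV] exI[of _ "\<lambda>x. x"])
      (simp add: coordinate_chart_ident geodesic_flat_kropina_iff_collinear)
qed

end
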